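(* Let $n\geq 2$ be a positive integer. Then there exist a ring $R$ and a nonzero weakly $1$-absorbing prime ideal $I$ of $R$ such that there are exactly $n$ prime ideals of $R$ that are minimal over $I$.
   Context: All rings are commutative with identity. A proper ideal $I$ of a ring $R$ (i.e. $I\neq R$) is called weakly $1$-absorbing prime if for all nonunit elements $a,b,c\in R$ with $0\neq abc\in I$, either $ab\in I$ or $c\in I$. *)

theory Defs
  imports Complex_Main "HOL-Algebra.Ideal"
begin

locale weakly_1_absorbing_primeideal = ideal I R + cring R for I and R (structure) +
  assumes I_notcarr: "I \<noteq> carrier R"
    and I_weakly_1_absorbing:
      "\<lbrakk>a \<in> carrier R - Units R; b \<in> carrier R - Units R; c \<in> carrier R - Units R;
        a \<otimes> b \<otimes> c \<noteq> \<zero>; a \<otimes> b \<otimes> c \<in> I\<rbrakk> \<Longrightarrow> a \<otimes> b \<in> I \<or> c \<in> I"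

definition minimal_primes_over :: "('a, 'b) ring_scheme \<Rightarrow> 'a set \<Rightarrow> 'a set set" where
  "minimal_primes_over R I =
     {P. primeideal P R \<and> I \<subseteq> P \<and> (\<forall>Q. primeideal Q R \<and> I \<subseteq> Q \<and> Q \<subseteq> P \<longrightarrow> Q = P)}"

text \<open>
  HOL has no existential quantifier over types, so an existence claim about rings has to name a type
  containing the carrier. We use \<^typ>\<open>nat \<Rightarrow> rat\<close>, which has the cardinality of the continuum; the
  ring structure and the carrier (an arbitrary subset of the type) remain existentially quantified,
  and the ring operations need not be related to the operations on rational sequences.
\<close>

type_synonym ambient = "nat \<Rightarrow> rat"

end

(* Idealize a local ring A with exactly n minimal primes at its residue field k: in A (+) k the
   square-zero summand I = 0 (+) k is annihilated by every nonunit, so a product of three nonunits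
   lies in I only if it is zero and I is weakly 1-absorbing prime vacuously.  The primes over I are
   the primes of A.  For A take the n-tuples of rational power series with a common constant term
   (n lines meeting in a point): its minimal primes are the kernels of the n coordinate maps. *)
theory Submission
  imports Defs "HOL-Computational_Algebra.Formal_Power_Series" "HOL-Library.Nat_Bijection"
begin

text \<open>If each \<open>J i\<close> had an element outside \<open>I\<close>, the product of these
  elements would lie in every \<open>J i\<close> but, by primality, not in \<open>I\<close>. The
  empty family is covered by the start value \<open>\<one>\<close>, which avoids a proper
  ideal.\<close>

lemma (in primeideal) INT_subset_imp_subset:
  assumes "finite A" and "\<And>i. i \<in> A \<Longrightarrow> ideal (J i) R"
    and "{x \<in> carrier R. \<forall>i\<in>A. x \<in> J i} \<subseteq> I"
  shows "\<exists>i\<in>A. J i \<subseteq> I"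
proof (rule ccontr)
  assume neg: "\<not> ?thesis"
  have "\<exists>b\<in>carrier R - I. \<forall>i\<in>A. b \<in> J i"
    using assms(1,2) neg
  proof (induction A rule: finite_induct)
    case empty
    have "\<one> \<notin> I"
      using I_notcarr one_imp_carrier by blast
    then show ?case by blast
  next
    case (insert k A)
    then obtain b where b: "b \<in> carrier R - I" "\<forall>i\<in>A. b \<in> J i" by auto
    obtain a where a: "a \<in> J k" "a \<notin> I" using insert.prems(2) by auto
    have ac: "a \<in> carrier R"
      using ideal.Icarr[OF insert.prems(1), of k a] a(1) by simp
    have "b \<otimes> a \<in> carrier R - I"
      using b(1) ac a(2) I_prime by auto
    moreover have "b \<otimes> a \<in> J i" if "i \<in> insert k A" for i
    proof (cases "i = k")
      case True
      then show ?thesis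
        using ideal.I_l_closed[OF insert.prems(1), of k a b] a(1) b(1) by auto
    next
      case False
      then show ?thesis
        using ideal.I_r_closed[OF insert.prems(1), of i b a] ac b(2) that by auto
    qed
    ultimately show ?case by blast
  qed
  then show False using assms(3) by blast
qed

text \<open>Every prime over \<open>I\<close> contains some \<open>P i\<close> by the preceding
  lemma, so only the \<open>P i\<close> can be minimal; incomparability makes each of them
  so.\<close>

lemma minimal_primes_over_eq_image:
  assumes "finite A" and P: "\<And>i. i \<in> A \<Longrightarrow> primeideal (P i) R"
    and I: "{x \<in> carrier R. \<forall>i\<in>A. x \<in> P i} = I"
    and incomparable: "\<And>i j. i \<in> A \<Longrightarrow> j \<in> A \<Longrightarrow> P i \<subseteq> P j \<Longrightarrow> i = j"
  shows "minimal_primes_over R I = P ` A"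
proof -
  have above: "\<exists>i\<in>A. P i \<subseteq> Q" if "primeideal Q R" "I \<subseteq> Q" for Q
    using primeideal.INT_subset_imp_subset[OF that(1) assms(1), of P] P that(2) I
    by (blast dest: primeideal.axioms(1))
  have IP: "I \<subseteq> P i" if "i \<in> A" for i
    using I that by blast
  show ?thesis
  proof (intro equalityI subsetI)
    fix Q assume "Q \<in> minimal_primes_over R I"
    then have Q: "primeideal Q R" "I \<subseteq> Q"
      and min: "\<And>Q'. primeideal Q' R \<Longrightarrow> I \<subseteq> Q' \<Longrightarrow> Q' \<subseteq> Q \<Longrightarrow> Q' = Q"
      by (auto simp: minimal_primes_over_def)
    then show "Q \<in> P ` A"
      using above[OF Q] P IP by blast
  next
    fix Q assume "Q \<in> P ` A"
    then obtain i where i: "i \<in> A" "Q = P i" by blast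
    have "Q' = P i" if Q': "primeideal Q' R" "I \<subseteq> Q'" "Q' \<subseteq> P i" for Q'
    proof -
      obtain j where "j \<in> A" "P j \<subseteq> Q'" using above[OF Q'(1,2)] by blast
      with Q'(3) incomparable[of j i] i(1) show ?thesis by blast
    qed
    then show "Q \<in> minimal_primes_over R I"
      using i P IP by (auto simp: minimal_primes_over_def)
  qed
qed

text \<open>
  A sequence encodes a pair of a rational number (its entry 0) and a sequence of power series.
\<close>

definition series_at :: "ambient \<Rightarrow> nat \<Rightarrow> rat fps" where
  "series_at a i = Abs_fps (\<lambda>j. a (Suc (prod_encode (i, j))))"

definition encode :: "rat \<Rightarrow> (nat \<Rightarrow> rat fps) \<Rightarrow> ambient" where
  "encode t F = case_nat t (\<lambda>m. fps_nth (F (fst (prod_decode m))) (snd (prod_decode m)))"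

lemma encode_0 [simp]: "encode t F 0 = t"
  by (simp add: encode_def)

lemma series_at_encode [simp]: "series_at (encode t F) i = F i"
  by (simp add: encode_def series_at_def fps_eq_iff)

lemma ambient_eq_iff: "a = b \<longleftrightarrow> a 0 = b 0 \<and> (\<forall>i. series_at a i = series_at b i)"
proof
  assume eq: "a 0 = b 0 \<and> (\<forall>i. series_at a i = series_at b i)"
  show "a = b"
  proof
    fix m
    show "a m = b m"
    proof (cases m)
      case 0
      then show ?thesis using eq by simp
    next
      case (Suc k)
      obtain i j where "k = prod_encode (i, j)"
        by (metis prod_decode_inverse surj_pair)
      moreover have "fps_nth (series_at a i) j = fps_nth (series_at b i) j"
        using eq by simp
      ultimately show ?thesis using Suc by (simp add: series_at_def)
    qed
  qed
qed simp

definition const_term :: "ambient \<Rightarrow> rat" where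
  "const_term a = fps_nth (series_at a 0) 0"

text \<open>
  Only the first \<open>n\<close> series are free; the remaining ones are the common constant term, so that the
  unit has the series 1 at every index.
\<close>

definition lines_ring :: "nat \<Rightarrow> ambient ring" where
  "lines_ring n =
     \<lparr>carrier = {a. (\<forall>i. fps_nth (series_at a i) 0 = const_term a) \<and>
                    (\<forall>i\<ge>n. series_at a i = fps_const (const_term a))},
      monoid.mult = \<lambda>a b. encode (const_term a * b 0 + a 0 * const_term b)
                          (\<lambda>i. series_at a i * series_at b i),
      monoid.one = encode 0 (\<lambda>_. 1),
      ring.zero = encode 0 (\<lambda>_. 0),
      ring.add = \<lambda>a b. encode (a 0 + b 0) (\<lambda>i. series_at a i + series_at b i)\<rparr>"

lemma const_term_encode [simp]: "const_term (encode t F) = fps_nth (F 0) 0"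
  by (simp add: const_term_def)

text \<open>\<open>const_term\<close> is additive and multiplicative, so series act on entry 0
  through it as on a module. Multiplication is then that of an idealization, and every axiom is
  checked componentwise.\<close>

lemma cring_lines_ring: "cring (lines_ring n)"
proof (rule cringI)
  show "abelian_group (lines_ring n)"
  proof (rule abelian_groupI)
    fix x assume x: "x \<in> carrier (lines_ring n)"
    show "\<exists>y\<in>carrier (lines_ring n). y \<oplus>\<^bsub>lines_ring n\<^esub> x = \<zero>\<^bsub>lines_ring n\<^esub>"
      by (rule bexI[where x = "encode (- x 0) (\<lambda>i. - series_at x i)"])
        (use x in \<open>auto simp: lines_ring_def ambient_eq_iff\<close>)
  qed (auto simp: lines_ring_def ambient_eq_iff)
  show "comm_monoid (lines_ring n)"
    by (rule comm_monoidI)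
      (auto simp: lines_ring_def ambient_eq_iff algebra_simps)
qed (auto simp: lines_ring_def ambient_eq_iff algebra_simps)

text \<open>Locality of the ring, used as: nonunits have constant term 0.\<close>

lemma Units_lines_ring:
  assumes a: "a \<in> carrier (lines_ring n)" and c: "const_term a \<noteq> 0"
  shows "a \<in> Units (lines_ring n)"
proof -
  interpret cring "lines_ring n" by (rule cring_lines_ring)
  \<comment> \<open>Entry 0 is the solution \<open>t\<close> of
    \<open>const_term a * t + a 0 / const_term a = 0\<close>.\<close>
  let ?b = "encode (- a 0 / (const_term a)\<^sup>2) (\<lambda>i. inverse (series_at a i))"
  have nz: "fps_nth (series_at a i) 0 \<noteq> 0" for i
    using a c by (simp add: lines_ring_def)
  have b: "?b \<in> carrier (lines_ring n)"
    using a c by (auto simp: lines_ring_def fps_const_inverse)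
  have "a \<otimes>\<^bsub>lines_ring n\<^esub> ?b = \<one>\<^bsub>lines_ring n\<^esub>"
    using c nz
    by (auto simp: lines_ring_def ambient_eq_iff inverse_mult_eq_1' const_term_def[symmetric]
        field_simps power2_eq_square)
  with a b m_comm[OF a b] show ?thesis
    unfolding Units_def by auto
qed

text \<open>The square-zero summand: entry 0 is left free.\<close>

definition residue_ideal :: "nat \<Rightarrow> ambient set" where
  "residue_ideal n = {a \<in> carrier (lines_ring n). \<forall>i. series_at a i = 0}"

definition line_ideal :: "nat \<Rightarrow> nat \<Rightarrow> ambient set" where
  "line_ideal n i = {a \<in> carrier (lines_ring n). series_at a i = 0}"

text \<open>Treats \<open>residue_ideal\<close> and \<open>line_ideal\<close> at once, with
  \<open>S\<close> equal to \<open>UNIV\<close> or a singleton.\<close>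

lemma ideal_lines_ringI:
  assumes "J = {a \<in> carrier (lines_ring n). \<forall>i\<in>S. series_at a i = 0}"
  shows "ideal J (lines_ring n)"
proof -
  interpret cring "lines_ring n" by (rule cring_lines_ring)
  have closed: "a \<oplus>\<^bsub>lines_ring n\<^esub> b \<in> J" if "a \<in> J" "b \<in> J" for a b
    using that assms add.m_closed[of a b] by (auto simp: lines_ring_def)
  have absorb: "x \<otimes>\<^bsub>lines_ring n\<^esub> a \<in> J" if "a \<in> J" "x \<in> carrier (lines_ring n)" for a x
    using that assms m_closed[of x a] by (auto simp: lines_ring_def)
  have sub: "J \<subseteq> carrier (lines_ring n)" using assms by auto
  have minus: "\<ominus>\<^bsub>lines_ring n\<^esub> a \<in> J" if "a \<in> J" for a
    using absorb[OF that a_inv_closed[OF one_closed]] that sub l_minus[of "\<one>\<^bsub>lines_ring n\<^esub>" a]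
    by auto
  have zero: "\<zero>\<^bsub>lines_ring n\<^esub> \<in> J"
    using assms zero_closed by (auto simp: lines_ring_def)
  show ?thesis
  proof (rule idealI[OF ring_axioms])
    show "subgroup J (add_monoid (lines_ring n))"
      by (rule add.subgroupI) (use closed minus zero sub in auto)
    show "a \<otimes>\<^bsub>lines_ring n\<^esub> x \<in> J" if "a \<in> J" "x \<in> carrier (lines_ring n)" for a x
      using absorb[OF that] m_comm[of a x] that sub by auto
  qed (rule absorb)
qed

text \<open>The coordinate map at \<open>i\<close> is a homomorphism into the domain
  \<open>rat fps\<close>. For \<open>i \<ge> n\<close> its kernel is the maximal ideal.\<close>

lemma primeideal_line_ideal: "primeideal (line_ideal n i) (lines_ring n)"
proof (rule primeidealI)
  show "ideal (line_ideal n i) (lines_ring n)"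
    by (rule ideal_lines_ringI[where S = "{i}"]) (auto simp: line_ideal_def)
  have "\<one>\<^bsub>lines_ring n\<^esub> \<in> carrier (lines_ring n) - line_ideal n i"
    by (simp add: line_ideal_def lines_ring_def)
  then show "carrier (lines_ring n) \<noteq> line_ideal n i" by blast
qed (rule cring_lines_ring, auto simp: line_ideal_def lines_ring_def)

lemma weakly_1_absorbing_residue_ideal:
  "weakly_1_absorbing_primeideal (residue_ideal n) (lines_ring n)"
proof -
  let ?R = "lines_ring n"
  have id: "ideal (residue_ideal n) ?R"
    by (rule ideal_lines_ringI[where S = UNIV]) (auto simp: residue_ideal_def)
  interpret ideal "residue_ideal n" ?R by (rule id)
  interpret cring ?R by (rule cring_lines_ring)
  show ?thesis
  proof
    have "\<one>\<^bsub>?R\<^esub> \<in> carrier ?R - residue_ideal n"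
      by (simp add: residue_ideal_def lines_ring_def)
    then show "residue_ideal n \<noteq> carrier ?R" by blast
    fix a b c
    assume "a \<in> carrier ?R - Units ?R" "b \<in> carrier ?R - Units ?R" "c \<in> carrier ?R - Units ?R"
    then have "const_term a = 0" "const_term b = 0" "const_term c = 0"
      using Units_lines_ring by blast+
    moreover assume "a \<otimes>\<^bsub>?R\<^esub> b \<otimes>\<^bsub>?R\<^esub> c \<in> residue_ideal n" "a \<otimes>\<^bsub>?R\<^esub> b \<otimes>\<^bsub>?R\<^esub> c \<noteq> \<zero>\<^bsub>?R\<^esub>"
    \<comment> \<open>Vanishing constant terms make entry 0 of the triple product 0, and membership
      in the ideal kills its series. The product is thus zero, contrary to assumption.\<close>
    ultimately show "a \<otimes>\<^bsub>?R\<^esub> b \<in> residue_ideal n \<or> c \<in> residue_ideal n"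
      by (auto simp: residue_ideal_def lines_ring_def ambient_eq_iff const_term_def[symmetric])
  qed
qed

lemma line_ideal_incomparable:
  assumes "i < n" "j < n" and sub: "line_ideal n i \<subseteq> line_ideal n j"
  shows "i = j"
proof (rule ccontr)
  assume "i \<noteq> j"
  \<comment> \<open>The coordinate function of line \<open>j\<close>, zero on all other lines; all
    its constant terms are 0, so it lies in the carrier.\<close>
  let ?e = "encode 0 (\<lambda>k. if k = j then fps_X else 0)"
  have "?e \<in> line_ideal n i"
    using assms(1,2) \<open>i \<noteq> j\<close> by (auto simp: line_ideal_def lines_ring_def)
  then have "?e \<in> line_ideal n j" using sub by blast
  then show False by (simp add: line_ideal_def)
qed

lemma minimal_primes_over_residue_ideal:
  assumes "n > 0"
  shows "minimal_primes_over (lines_ring n) (residue_ideal n) = line_ideal n ` {..<n}"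
proof (rule minimal_primes_over_eq_image)
  have "series_at a i = 0"
    if a: "a \<in> carrier (lines_ring n)" "\<forall>i<n. series_at a i = 0" for a i
  proof (cases "i < n")
    case False
    \<comment> \<open>The common constant term is read off series 0, which vanishes because
      \<open>0 < n\<close>.\<close>
    then have "series_at a i = fps_const (const_term a)" using a(1) by (simp add: lines_ring_def)
    then show ?thesis using a(2) assms by (simp add: const_term_def)
  qed (use a(2) in simp)
  then show "{x \<in> carrier (lines_ring n). \<forall>i\<in>{..<n}. x \<in> line_ideal n i} = residue_ideal n"
    by (auto simp: line_ideal_def residue_ideal_def)
qed (auto simp: primeideal_line_ideal line_ideal_incomparable)

theorem theorem2p12:
  fixes n :: nat
  assumes "n \<ge> 2"
  shows "\<exists>(R :: ambient ring) I.
           cring R \<and> weakly_1_absorbing_primeideal I R \<and> I \<noteq> {\<zero>\<^bsub>R\<^esub>} \<and>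
           card (minimal_primes_over R I) = n"
proof (intro exI conjI)
  show "cring (lines_ring n)" by (rule cring_lines_ring)
  show "weakly_1_absorbing_primeideal (residue_ideal n) (lines_ring n)"
    by (rule weakly_1_absorbing_residue_ideal)
  have "encode 1 (\<lambda>_. 0) \<in> residue_ideal n"
    by (simp add: residue_ideal_def lines_ring_def)
  moreover have "encode 1 (\<lambda>_. 0) \<noteq> \<zero>\<^bsub>lines_ring n\<^esub>"
    by (simp add: lines_ring_def ambient_eq_iff)
  ultimately show "residue_ideal n \<noteq> {\<zero>\<^bsub>lines_ring n\<^esub>}" by blast
  have "inj_on (line_ideal n) {..<n}"
    by (auto intro!: inj_onI line_ideal_incomparable)
  then show "card (minimal_primes_over (lines_ring n) (residue_ideal n)) = n"
    using assms by (simp add: minimal_primes_over_residue_ideal card_image)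
qed

end
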